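(* Each interpolating Blaschke product has weak Property $\mathfrak{H}$.
   Context: $\mathbb{D}$ is the open unit disk. An inner function is a bounded analytic function on $\mathbb{D}$ with unimodular radial limits almost everywhere on $\partial\mathbb{D}$. A Blaschke product is an inner function $B(z)=\lambda z^m\prod_n\frac{|\alpha_n|}{\alpha_n}\frac{\alpha_n-z}{1-\overline{\alpha_n}z}$ with $|\lambda|=1$, $m\ge0$ an integer, $\{\alpha_n\}$ a finite or infinite sequence in $\mathbb{D}\setminus\{0\}$ with $\sum_n(1-|\alpha_n|)<\infty$. A Blaschke product with zero sequence $\{z_n\}$ is interpolating if for every bounded sequence of complex numbers $\{w_n\}$ there is $f\in H^\infty$ (bounded analytic on $\mathbb{D}$) with $f(z_n)=w_n$ for all $n$; by Carleson's theorem this is equivalent to $\inf_n\prod_{k\ne n}\left|\frac{z_k-z_n}{1-\overline{z_k}z_n}\right|>0$. For an inner function $u$ and $\theta\in(0,1)$ put $\Omega_{u,\theta}=\{z\in\mathbb{D}:|u(z)|<\theta\}$. Let $\rho(z_1,z_2)=\left|\frac{z_1-z_2}{1-\overline{z_1}z_2}\right|$ and $\delta_{u,\eta}=\sup\{\rho(z_1,z_2): z_1,z_2 \text{ belong to the same connected component of }\Omega_{u,\eta}\}$. Weak Property $\mathfrak{B}$: there is $\theta\in(0,1)$ such that the closure of each component of $\Omega_{u,\theta}$ is contained in $\mathbb{D}$. Weak Property $\mathfrak{H}$: $u$ has weak Property $\mathfrak{B}$ and there exists $\eta\in(0,1)$ with $\delta_{u,\eta}<1$. *)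

theory Defs
  imports "HOL-Complex_Analysis.Complex_Analysis" "HOL-Library.Extended_Nat"
begin

text \<open>
  Functions on the open unit disk are total functions \<open>complex \<Rightarrow> complex\<close> of which only the
  values on \<open>ball 0 1\<close> matter.
\<close>

definition H_infinity :: "(complex \<Rightarrow> complex) \<Rightarrow> bool" where
  "H_infinity f \<longleftrightarrow> f holomorphic_on ball 0 1 \<and> bounded (f ` ball 0 1)"

text \<open>The circle is parametrised by \<open>cis\<close> on \<open>{0..2 * pi}\<close>.\<close>

definition inner_function :: "(complex \<Rightarrow> complex) \<Rightarrow> bool" where
  "inner_function u \<longleftrightarrow>
     H_infinity u \<and>
     (AE t in lebesgue_on {0..2 * pi}.
        \<exists>l. norm l = 1 \<and> ((\<lambda>r::real. u (of_real r * cis t)) \<longlongrightarrow> l) (at_left 1))"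

text \<open>
  A finite or infinite sequence is a function \<open>nat \<Rightarrow> complex\<close> together with a length \<open>N :: enat\<close>;
  entries with index at least \<open>N\<close> are irrelevant.
\<close>

definition blaschke_sequence :: "enat \<Rightarrow> (nat \<Rightarrow> complex) \<Rightarrow> bool" where
  "blaschke_sequence N \<alpha> \<longleftrightarrow>
     (\<forall>n. enat n < N \<longrightarrow> \<alpha> n \<in> ball 0 1 - {0}) \<and>
     summable (\<lambda>n. if enat n < N then 1 - norm (\<alpha> n) else 0)"

definition blaschke_factor :: "complex \<Rightarrow> complex \<Rightarrow> complex" where
  "blaschke_factor a z = of_real (norm a) / a * ((a - z) / (1 - cnj a * z))"

text \<open>
  \<open>blaschke_form c m N \<alpha> B\<close>: \<open>B\<close> is the Blaschke product with constant \<open>c\<close>, a zero of order \<open>m\<close>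
  at the origin, and zeros \<open>\<alpha> n\<close> (\<open>n < N\<close>) elsewhere.
\<close>

definition blaschke_form ::
  "complex \<Rightarrow> nat \<Rightarrow> enat \<Rightarrow> (nat \<Rightarrow> complex) \<Rightarrow> (complex \<Rightarrow> complex) \<Rightarrow> bool" where
  "blaschke_form c m N \<alpha> B \<longleftrightarrow>
     inner_function B \<and> norm c = 1 \<and> blaschke_sequence N \<alpha> \<and>
     (\<forall>z\<in>ball 0 1.
        B z = c * z ^ m * (\<Prod>n. if enat n < N then blaschke_factor (\<alpha> n) z else 1))"

text \<open>
  The full zero sequence, of length \<open>enat m + N\<close>: the origin \<open>m\<close> times, then the \<open>\<alpha> n\<close>.
  Zeros are repeated according to multiplicity.
\<close>

definition zero_sequence :: "nat \<Rightarrow> (nat \<Rightarrow> complex) \<Rightarrow> nat \<Rightarrow> complex" where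
  "zero_sequence m \<alpha> n = (if n < m then 0 else \<alpha> (n - m))"

definition interpolating_sequence :: "enat \<Rightarrow> (nat \<Rightarrow> complex) \<Rightarrow> bool" where
  "interpolating_sequence N z \<longleftrightarrow>
     (\<forall>w :: nat \<Rightarrow> complex. bounded (range w) \<longrightarrow>
        (\<exists>f. H_infinity f \<and> (\<forall>n. enat n < N \<longrightarrow> f (z n) = w n)))"

definition interpolating_blaschke_product :: "(complex \<Rightarrow> complex) \<Rightarrow> bool" where
  "interpolating_blaschke_product B \<longleftrightarrow>
     (\<exists>c m N \<alpha>. blaschke_form c m N \<alpha> B \<and>
        interpolating_sequence (enat m + N) (zero_sequence m \<alpha>))"

definition Omega :: "(complex \<Rightarrow> complex) \<Rightarrow> real \<Rightarrow> complex set" where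
  "Omega u \<theta> = {z \<in> ball 0 1. norm (u z) < \<theta>}"

definition pseudohyperbolic :: "complex \<Rightarrow> complex \<Rightarrow> real" where
  "pseudohyperbolic z w = norm ((z - w) / (1 - cnj z * w))"

text \<open>
  Inserting \<open>0\<close> fixes the convention that the supremum is \<open>0\<close> when \<open>Omega u \<eta>\<close> is empty; otherwise
  it changes nothing, since \<open>pseudohyperbolic z z = 0\<close>.
\<close>

definition delta :: "(complex \<Rightarrow> complex) \<Rightarrow> real \<Rightarrow> real" where
  "delta u \<eta> = Sup (insert 0
     {pseudohyperbolic z w | z w C. C \<in> components (Omega u \<eta>) \<and> z \<in> C \<and> w \<in> C})"

definition weak_property_B :: "(complex \<Rightarrow> complex) \<Rightarrow> bool" where
  "weak_property_B u \<longleftrightarrow>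
     (\<exists>\<theta>\<in>{0<..<1}. \<forall>C\<in>components (Omega u \<theta>). closure C \<subseteq> ball 0 1)"

definition weak_property_H :: "(complex \<Rightarrow> complex) \<Rightarrow> bool" where
  "weak_property_H u \<longleftrightarrow> weak_property_B u \<and> (\<exists>\<eta>\<in>{0<..<1}. delta u \<eta> < 1)"

end

theory Submission
  imports Defs
begin

text \<open>
  By Baire category and Montel, an interpolating sequence \<open>a\<close> interpolates with a uniform
  constant, and dividing out zeros gives \<open>\<Prod>k\<in>F. \<rho> (a k) (a n) \<ge> d\<close> for all finite \<open>F\<close> not
  containing \<open>n\<close>. By Schwarz--Pick every finite partial product is at least \<open>d\<^sup>2 / 8\<close> in modulus on
  the circles \<open>\<rho> (a n) z = d / 4\<close>, hence off the disks they bound by the maximum principle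
  applied to the reciprocal, and so is \<open>B\<close> in the limit. The components of
  \<open>Omega B (d\<^sup>2 / 8)\<close> therefore lie in single disks, which are pairwise disjoint and have
  pseudohyperbolic diameter at most \<open>3 d / 4\<close>.
\<close>

section \<open>Pseudohyperbolic distance and Schwarz-Pick estimates\<close>

lemma pseudohyperbolic_Moebius: "pseudohyperbolic a z = norm (Moebius_function 0 a z)"
  by (simp add: pseudohyperbolic_def Moebius_function_simple norm_divide norm_minus_commute)

lemma pseudohyperbolic_commute: "pseudohyperbolic a z = pseudohyperbolic z a"
proof -
  have "norm (1 - cnj a * z) = norm (cnj (1 - cnj a * z))"
    by (simp only: complex_mod_cnj)
  then show ?thesis
    by (simp add: pseudohyperbolic_def norm_divide norm_minus_commute mult.commute)
qed

lemma one_minus_cnj_mult_nonzero: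
  assumes "norm a < 1" "norm z \<le> 1"
  shows "1 - cnj a * z \<noteq> 0"
proof
  assume "1 - cnj a * z = 0"
  then have "norm (cnj a * z) = 1"
    by (metis eq_iff_diff_eq_0 norm_one)
  moreover have "norm (cnj a * z) \<le> norm a * 1"
    unfolding norm_mult complex_mod_cnj using assms by (intro mult_left_mono) auto
  ultimately show False using assms by simp
qed

lemma pseudohyperbolic_eq_0_iff:
  assumes "norm a < 1" "norm z < 1"
  shows "pseudohyperbolic a z = 0 \<longleftrightarrow> a = z"
  using one_minus_cnj_mult_nonzero[of a z] assms by (auto simp: pseudohyperbolic_def)

text \<open>Schwarz's lemma for \<open>f\<close> composed with the disk automorphism
  \<open>\<phi>\<close> taking 0 to \<open>a\<close>. It requires a strict bound, so
  \<open>f\<close> is scaled by \<open>L + e\<close>, and \<open>e\<close> tends to 0 at the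
  end.\<close>

lemma Schwarz_Pick_zero:
  assumes f: "f holomorphic_on ball 0 1" and L: "\<And>z. norm z < 1 \<Longrightarrow> norm (f z) \<le> L"
    and a: "norm a < 1" and z: "norm z < 1" and "f a = 0"
  shows "norm (f z) \<le> L * pseudohyperbolic a z"
proof -
  define \<phi> where "\<phi> = Moebius_function 0 (- a)"
  define p where "p = pseudohyperbolic a z"
  have "L \<ge> 0" using L[OF a] \<open>f a = 0\<close> by simp
  have p: "p < 1" "p \<ge> 0"
    unfolding p_def pseudohyperbolic_Moebius using Moebius_function_norm_lt_1[OF a z] by auto
  have \<phi>: "norm (\<phi> w) < 1" if "norm w < 1" for w
    unfolding \<phi>_def using that a by (intro Moebius_function_norm_lt_1) auto
  have "\<phi> holomorphic_on ball 0 1"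
    unfolding \<phi>_def using a by (intro Moebius_function_holomorphic) auto
  then have hol: "(f \<circ> \<phi>) holomorphic_on ball 0 1"
    using f by (rule holomorphic_on_compose_gen) (use \<phi> in auto)
  have \<phi>z: "\<phi> (Moebius_function 0 a z) = z"
    unfolding \<phi>_def using a z by (intro Moebius_function_compose) auto
  have "norm (f z) \<le> (L + e) * p" if "e > 0" for e
  proof -
    have "norm ((f \<circ> \<phi>) (Moebius_function 0 a z) / of_real (L + e)) \<le> norm (Moebius_function 0 a z)"
    proof (rule Schwarz_Lemma(1)[where f = "\<lambda>w. (f \<circ> \<phi>) w / of_real (L + e)"])
      show "(\<lambda>w. (f \<circ> \<phi>) w / complex_of_real (L + e)) holomorphic_on ball 0 1"
        using \<open>e > 0\<close> \<open>L \<ge> 0\<close>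
        by (intro holomorphic_on_divide hol holomorphic_on_const) (auto simp del: of_real_add)
      show "(f \<circ> \<phi>) 0 / complex_of_real (L + e) = 0"
        using \<open>f a = 0\<close> by (simp add: \<phi>_def Moebius_function_of_zero)
      show "norm ((f \<circ> \<phi>) w / complex_of_real (L + e)) < 1" if "norm w < 1" for w
        using L[OF \<phi>[OF that]] \<open>e > 0\<close> \<open>L \<ge> 0\<close>
        by (simp add: norm_divide divide_simps del: of_real_add)
      show "norm (Moebius_function 0 a z) < 1" using Moebius_function_norm_lt_1[OF a z] .
    qed
    then show ?thesis
      using \<phi>z \<open>e > 0\<close> \<open>L \<ge> 0\<close>
      by (simp add: p_def pseudohyperbolic_Moebius norm_divide divide_simps mult.commute
          del: of_real_add)
  qed
  then have "norm (f z) \<le> L * p + e" if "e > 0" for e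
    using that p mult_left_le[of p e] by (smt (verit) distrib_right)
  then show ?thesis unfolding p_def by (rule field_le_epsilon)
qed

text \<open>\<open>f z - f a\<close> vanishes at \<open>a\<close> and is bounded by
  \<open>2 * L\<close>, which is where the factor 2 comes from.\<close>

lemma Schwarz_Pick_Lipschitz:
  assumes f: "f holomorphic_on ball 0 1" and L: "\<And>z. norm z < 1 \<Longrightarrow> norm (f z) \<le> L"
    and a: "norm a < 1" and z: "norm z < 1"
  shows "norm (f z - f a) \<le> 2 * L * pseudohyperbolic a z"
proof (rule Schwarz_Pick_zero[where f = "\<lambda>z. f z - f a", OF _ _ a z])
  show "norm (f z - f a) \<le> 2 * L" if "norm z < 1" for z
    using L[OF that] L[OF a] norm_triangle_ineq4[of "f z" "f a"] by linarith
qed (use f in \<open>auto intro!: holomorphic_intros\<close>)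

section \<open>Dividing out zeros\<close>

text \<open>Removing a zero does not increase the bound: away from \<open>a\<close> the Schwarz-Pick
  estimate contains exactly the factor to cancel, and at \<open>a\<close> the bound follows by
  continuity.\<close>

lemma Blaschke_divide:
  assumes f: "f holomorphic_on ball 0 1" and L: "\<And>z. norm z < 1 \<Longrightarrow> norm (f z) \<le> L"
    and a: "norm a < 1" and "f a = 0"
  obtains g where "g holomorphic_on ball 0 1" "\<And>z. norm z < 1 \<Longrightarrow> norm (g z) \<le> L"
    "\<And>z. norm z < 1 \<Longrightarrow> f z = g z * Moebius_function 0 a z"
proof -
  \<comment> \<open>The difference quotient of \<open>f\<close> at \<open>a\<close>, with its
    removable singularity filled in.\<close>
  define k where "k = (\<lambda>z. if z = a then deriv f a else f z / (z - a))"
  define g where "g = (\<lambda>z. k z * (1 - cnj a * z))"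
  have "k holomorphic_on ball 0 1"
    by (rule pole_theorem_open_0[OF f, of a]) (use \<open>f a = 0\<close> in \<open>auto simp: k_def\<close>)
  then have g: "g holomorphic_on ball 0 1"
    unfolding g_def by (intro holomorphic_intros)
  have fg: "f z = g z * Moebius_function 0 a z" if "norm z < 1" for z
    using one_minus_cnj_mult_nonzero[OF a, of z] that \<open>f a = 0\<close>
    by (auto simp: g_def k_def Moebius_function_simple)
  have g_le: "norm (g z) \<le> L" if "norm z < 1" "z \<noteq> a" for z
  proof -
    have "norm (g z) * pseudohyperbolic a z \<le> L * pseudohyperbolic a z"
      using Schwarz_Pick_zero[OF f L a that(1) \<open>f a = 0\<close>]
      by (simp add: fg[OF that(1)] norm_mult pseudohyperbolic_Moebius)
    moreover have "pseudohyperbolic a z > 0"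
      using pseudohyperbolic_eq_0_iff[OF a that(1)] that(2) by (auto simp: pseudohyperbolic_def)
    ultimately show ?thesis by simp
  qed
  have "norm (g a) \<le> L"
  proof (rule Lim_norm_ubound)
    show "(g \<longlongrightarrow> g a) (at a)"
      using holomorphic_on_imp_continuous_on[OF g] a
      by (auto simp: continuous_on_eq_continuous_at isCont_def)
    have "\<forall>\<^sub>F z in at a. z \<in> ball 0 1 \<and> z \<noteq> a"
      using a by (intro eventually_conj eventually_at_in_open' eventually_neq_at_within) auto
    then show "\<forall>\<^sub>F z in at a. norm (g z) \<le> L"
      by eventually_elim (use g_le in auto)
  qed auto
  with g_le have "norm (g z) \<le> L" if "norm z < 1" for z using that by blast
  with g fg show ?thesis using that by blast
qed

text \<open>The zeros are divided out one at a time. Since the points are distinct, the divisor does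
  not vanish at the remaining ones, so the quotient still does.\<close>

lemma Blaschke_divide_prod:
  assumes "finite F"
    and "f holomorphic_on ball 0 1" and "\<And>z. norm z < 1 \<Longrightarrow> norm (f z) \<le> L"
    and "\<And>k. k \<in> F \<Longrightarrow> norm (a k) < 1 \<and> f (a k) = 0" and "inj_on a F"
    and "norm z < 1"
  shows "norm (f z) \<le> L * (\<Prod>k\<in>F. pseudohyperbolic (a k) z)"
  using assms
proof (induction F arbitrary: f rule: finite_induct)
  case (insert j F)
  obtain g where g: "g holomorphic_on ball 0 1" "\<And>z. norm z < 1 \<Longrightarrow> norm (g z) \<le> L"
    and fg: "\<And>z. norm z < 1 \<Longrightarrow> f z = g z * Moebius_function 0 (a j) z"
    using Blaschke_divide[of f L "a j"] insert.prems by (metis insertI1)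
  have "norm (g z) \<le> L * (\<Prod>k\<in>F. pseudohyperbolic (a k) z)"
  proof (rule insert.IH[OF g])
    fix k assume "k \<in> F"
    then have "a j \<noteq> a k" using insert.hyps insert.prems by (auto simp: inj_on_def)
    then have "Moebius_function 0 (a j) (a k) \<noteq> 0"
      using pseudohyperbolic_eq_0_iff[of "a j" "a k"] insert.prems \<open>k \<in> F\<close>
      by (auto simp: pseudohyperbolic_Moebius)
    then show "norm (a k) < 1 \<and> g (a k) = 0"
      using fg[of "a k"] insert.prems \<open>k \<in> F\<close> by auto
  qed (use insert.prems in auto)
  then have "norm (g z) * pseudohyperbolic (a j) z \<le>
      L * (\<Prod>k\<in>F. pseudohyperbolic (a k) z) * pseudohyperbolic (a j) z"
    by (rule mult_right_mono) (simp add: pseudohyperbolic_def)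
  moreover have "norm (f z) = norm (g z) * pseudohyperbolic (a j) z"
    using fg[OF \<open>norm z < 1\<close>] by (simp add: norm_mult pseudohyperbolic_Moebius)
  ultimately show ?case using insert.hyps by (simp add: mult_ac)
qed simp

section \<open>Interpolation with a uniform constant\<close>

text \<open>A Montel subsequence has a holomorphic limit with the same bound and the prescribed
  values. This makes the sets in the Baire argument closed.\<close>

lemma bounded_holomorphic_limit:
  fixes f :: "nat \<Rightarrow> complex \<Rightarrow> complex"
  assumes f: "\<And>n. f n holomorphic_on ball 0 1" and le: "\<And>n z. norm z < 1 \<Longrightarrow> norm (f n z) \<le> L"
    and lim: "\<And>a. a \<in> A \<Longrightarrow> (\<lambda>n. f n a) \<longlonglongrightarrow> w a" and A: "A \<subseteq> ball 0 1"
  obtains g where "g holomorphic_on ball 0 1" "\<And>z. norm z < 1 \<Longrightarrow> norm (g z) \<le> L"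
    "\<And>a. a \<in> A \<Longrightarrow> g a = w a"
proof -
  obtain g r where g: "g holomorphic_on ball 0 1" and r: "strict_mono (r :: nat \<Rightarrow> nat)"
    and gz: "\<And>z. z \<in> ball 0 1 \<Longrightarrow> (\<lambda>n. f (r n) z) \<longlonglongrightarrow> g z"
  proof (rule Montel[of "ball 0 1" "range f" f])
    show "\<exists>B. \<forall>h\<in>range f. \<forall>z\<in>K. norm (h z) \<le> B" if "K \<subseteq> ball 0 1" for K
      using that le by (intro exI[of _ L]) auto
  qed (use f in auto)
  show thesis
  proof
    show "g holomorphic_on ball 0 1" by fact
    show "norm (g z) \<le> L" if "norm z < 1" for z
      using gz[of z] le that by (intro Lim_norm_ubound[of sequentially]) auto
    show "g a = w a" if "a \<in> A" for a
      using LIMSEQ_unique[OF gz, of a] LIMSEQ_subseq_LIMSEQ[OF lim[OF that] r] A that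
      by (auto simp: o_def)
  qed
qed

text \<open>The library instance asks for a metric on the domain, which \<open>nat\<close> lacks.\<close>

lemma complete_UNIV_bcontfun:
  "complete (UNIV :: ('a::topological_space \<Rightarrow>\<^sub>C 'b::complete_space) set)"
proof (rule completeI)
  fix f :: "nat \<Rightarrow> 'a \<Rightarrow>\<^sub>C 'b"
  assume "Cauchy f"
  then have "uniformly_Cauchy_on UNIV (\<lambda>n. apply_bcontfun (f n))"
    unfolding Cauchy_def uniformly_Cauchy_on_def by (meson dist_fun_lt_imp_dist_val_lt)
  then have "uniformly_convergent_on UNIV (\<lambda>n. apply_bcontfun (f n))"
    by (rule Cauchy_uniformly_convergent)
  then obtain g where "uniform_limit UNIV (\<lambda>n. apply_bcontfun (f n)) g sequentially"
    unfolding uniformly_convergent_on_def by blast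
  then obtain l where "f \<longlonglongrightarrow> l"
    using uniform_limit_bcontfunE sequentially_bot by blast
  then show "\<exists>l\<in>UNIV. f \<longlonglongrightarrow> l" by blast
qed

text \<open>
  Baire category in place of the open mapping theorem for the restriction operator from
  \<open>H\<^sup>\<infinity>\<close> onto the bounded sequences.
\<close>

lemma interpolation_constant:
  fixes a :: "nat \<Rightarrow> complex"
  assumes a: "\<And>n. n \<in> A \<Longrightarrow> norm (a n) < 1"
    and interp: "\<And>w :: nat \<Rightarrow> complex. bounded (range w) \<Longrightarrow>
      \<exists>f. H_infinity f \<and> (\<forall>n\<in>A. f (a n) = w n)"
  obtains L where "L > 0"
    "\<And>w. (\<And>n. norm (w n) \<le> 1) \<Longrightarrow> \<exists>f. f holomorphic_on ball 0 1 \<and>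
      (\<forall>z. norm z < 1 \<longrightarrow> norm (f z) \<le> L) \<and> (\<forall>n\<in>A. f (a n) = w n)"
proof -
  \<comment> \<open>Bounded sequences are encoded as bounded continuous functions on the discrete
    space \<open>nat\<close>, which supplies the sup norm. \<open>E M\<close> holds the data
    interpolated with bound \<open>M\<close>.\<close>
  define E where "E M = {w :: nat \<Rightarrow>\<^sub>C complex. \<exists>f. f holomorphic_on ball 0 1 \<and>
      (\<forall>z. norm z < 1 \<longrightarrow> norm (f z) \<le> M) \<and> (\<forall>n\<in>A. f (a n) = w n)}" for M :: real
  have closed: "closed (E M)" for M
    unfolding closed_sequential_limits
  proof (intro allI impI, elim conjE)
    fix x l assume x: "\<forall>n. x n \<in> E M" and lim: "x \<longlonglongrightarrow> l"
    then obtain f where f: "\<And>n. f n holomorphic_on ball 0 1"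
      "\<And>n z. norm z < 1 \<Longrightarrow> norm (f n z) \<le> M" "\<And>n k. k \<in> A \<Longrightarrow> f n (a k) = x n k"
      unfolding E_def by (simp add: all_conj_distrib) metis
    have fl: "(\<lambda>n. f n (a k)) \<longlonglongrightarrow> l k" if "k \<in> A" for k
      using tendsto_uniform_limitI[OF tendsto_bcontfun_uniform_limit[OF lim], of k] f(3) that
      by simp
    have "inj_on a A"
    proof
      fix j k assume jk: "j \<in> A" "k \<in> A" "a j = a k"
      have "bounded (range (\<lambda>n. if n = j then 1 else (0 :: complex)))"
        by (rule boundedI[of _ 1]) auto
      from interp[OF this] jk show "j = k" by (metis zero_neq_one)
    qed
    then have lim': "(\<lambda>n. f n z) \<longlonglongrightarrow> l (inv_into A a z)" if "z \<in> a ` A" for z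
      using that fl by auto
    have "a ` A \<subseteq> ball 0 1" using a by auto
    then obtain g where "g holomorphic_on ball 0 1"
      "\<And>z. norm z < 1 \<Longrightarrow> norm (g z) \<le> M"
      "\<And>z. z \<in> a ` A \<Longrightarrow> g z = l (inv_into A a z)"
      using bounded_holomorphic_limit[OF f(1,2) lim'] by blast
    then show "l \<in> E M" unfolding E_def using \<open>inj_on a A\<close> by auto
  qed
  \<comment> \<open>The closed sets \<open>E (real n)\<close> cover the whole space, because every
    bounded sequence is interpolated by some bounded function; by Baire not all of them have empty
    interior.\<close>
  have "\<exists>n::nat. interior (E (real n)) \<noteq> {}"
  proof (rule ccontr)
    assume "\<not> ?thesis"
    moreover have "complete (UNIV :: (nat \<Rightarrow>\<^sub>C complex) set)" by (rule complete_UNIV_bcontfun)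
    ultimately have "euclidean interior_of \<Union> (range (\<lambda>n. E (real n))) = {}"
      using Met_TC.metric_Baire_category_alt[where 'a = "nat \<Rightarrow>\<^sub>C complex",
          of "range (\<lambda>n. E (real n))"] closed
      by auto
    moreover have "w \<in> \<Union> (range (\<lambda>n. E (real n)))" for w
    proof -
      obtain f where f: "H_infinity f" "\<forall>n\<in>A. f (a n) = w n"
        using interp[of w] by auto
      then obtain M where "\<forall>z\<in>ball 0 1. norm (f z) \<le> M"
        unfolding H_infinity_def bounded_iff by auto
      moreover obtain n where "M \<le> real n" using real_arch_simple by blast
      ultimately have "w \<in> E (real n)"
        using f unfolding E_def H_infinity_def by force
      then show ?thesis by blast
    qed
    then have "\<Union> (range (\<lambda>n. E (real n))) = UNIV" by blast
    ultimately show False by simp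
  qed
  then obtain M w0 e where e: "e > 0" and ball: "cball w0 e \<subseteq> E M"
    by (meson ex_in_conv mem_interior_cball)
  have "w0 \<in> E M" using e ball by auto
  then obtain f0 where f0: "f0 holomorphic_on ball 0 1" "\<And>z. norm z < 1 \<Longrightarrow> norm (f0 z) \<le> M"
      "\<And>n. n \<in> A \<Longrightarrow> f0 (a n) = w0 n"
    unfolding E_def by auto
  have M: "M \<ge> 0" using order_trans[OF norm_ge_zero f0(2)[of 0]] by simp
  show thesis
  proof
    \<comment> \<open>Both \<open>w0\<close> and \<open>w0 + e *\<^sub>R w1\<close> lie in
      \<open>E M\<close>, so the difference of their interpolants divided by \<open>e\<close>
      interpolates \<open>w\<close> with bound \<open>2 * M / e\<close>. Adding 1 keeps the constant
      positive when \<open>M = 0\<close>.\<close>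
    show "2 * M / e + 1 > 0" using e M by (simp add: add_nonneg_pos)
    fix w :: "nat \<Rightarrow> complex" assume w: "\<And>n. norm (w n) \<le> 1"
    define w1 where "w1 = Bcontfun w"
    have "w \<in> bcontfun" unfolding bcontfun_def using w by (auto intro: boundedI)
    then have [simp]: "apply_bcontfun w1 = w"
      unfolding w1_def by (simp add: Bcontfun_inverse)
    have "norm w1 \<le> 1" by (rule norm_bound) (use w in simp)
    then have "w0 + e *\<^sub>R w1 \<in> cball w0 e" using e by (simp add: dist_norm mult_left_le)
    then obtain f1 where f1: "f1 holomorphic_on ball 0 1"
      "\<And>z. norm z < 1 \<Longrightarrow> norm (f1 z) \<le> M"
      "\<And>n. n \<in> A \<Longrightarrow> f1 (a n) = w0 n + e *\<^sub>R w n"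
      using ball unfolding E_def by (auto simp: subset_iff)
    show "\<exists>f. f holomorphic_on ball 0 1 \<and> (\<forall>z. norm z < 1 \<longrightarrow> norm (f z) \<le> 2 * M / e + 1) \<and>
      (\<forall>n\<in>A. f (a n) = w n)"
    proof (intro exI[of _ "\<lambda>z. (f1 z - f0 z) / of_real e"] conjI allI impI ballI)
      show "(\<lambda>z. (f1 z - f0 z) / of_real e) holomorphic_on ball 0 1"
        using e f0 f1 by (intro holomorphic_intros) auto
      show "(f1 (a n) - f0 (a n)) / of_real e = w n" if "n \<in> A" for n
        using f1(3) f0(3) that e by (simp add: scaleR_conv_of_real)
      fix z :: complex assume z: "norm z < 1"
      have "norm (f1 z - f0 z) \<le> 2 * M"
        using norm_triangle_ineq4[of "f1 z" "f0 z"] f0(2)[OF z] f1(2)[OF z] by linarith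
      then have "norm (f1 z - f0 z) / e \<le> 2 * M / e" using e by (intro divide_right_mono) auto
      then show "norm ((f1 z - f0 z) / of_real e) \<le> 2 * M / e + 1"
        using e by (simp add: norm_divide)
    qed
  qed
qed

section \<open>Uniform separation\<close>

text \<open>Interpolate 1 at \<open>a n\<close> and 0 at all other points with bound
  \<open>L\<close>. Dividing out the zeros indexed by \<open>F\<close> and evaluating at
  \<open>a n\<close> gives 1 \<le> \<open>L\<close> times the product.\<close>

lemma interpolating_imp_uniformly_separated:
  fixes a :: "nat \<Rightarrow> complex"
  assumes a: "\<And>n. n \<in> A \<Longrightarrow> norm (a n) < 1"
    and interp: "\<And>w :: nat \<Rightarrow> complex. bounded (range w) \<Longrightarrow>
      \<exists>f. H_infinity f \<and> (\<forall>n\<in>A. f (a n) = w n)"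
  obtains d where "0 < d" "d \<le> 1"
    "\<And>n F. n \<in> A \<Longrightarrow> finite F \<Longrightarrow> F \<subseteq> A - {n} \<Longrightarrow>
      d \<le> (\<Prod>k\<in>F. pseudohyperbolic (a k) (a n))"
proof -
  obtain L where "L > 0" and
    L: "\<And>w. (\<And>n. norm (w n) \<le> 1) \<Longrightarrow> \<exists>f. f holomorphic_on ball 0 1 \<and>
      (\<forall>z. norm z < 1 \<longrightarrow> norm (f z) \<le> L) \<and> (\<forall>n\<in>A. f (a n) = w n)"
    using interpolation_constant[OF a interp] by blast
  have peak: "\<exists>f. f holomorphic_on ball 0 1 \<and> (\<forall>z. norm z < 1 \<longrightarrow> norm (f z) \<le> L) \<and>
     (\<forall>k\<in>A. f (a k) = (if k = n then 1 else 0))" for n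
    by (rule L) auto
  have inj: "inj_on a A"
    using peak by (intro inj_onI) (metis zero_neq_one)
  show thesis
  proof
    \<comment> \<open>The minimum with 1 covers empty \<open>A\<close>, where nothing forces
      \<open>L\<close> to be at least 1.\<close>
    show "0 < min 1 (1 / L)" "min 1 (1 / L) \<le> 1" using \<open>L > 0\<close> by auto
    fix n F assume n: "n \<in> A" "finite F" "F \<subseteq> A - {n}"
    obtain f where f: "f holomorphic_on ball 0 1" "\<And>z. norm z < 1 \<Longrightarrow> norm (f z) \<le> L"
      "\<And>k. k \<in> A \<Longrightarrow> f (a k) = (if k = n then 1 else 0)"
      using peak[of n] by auto
    have "norm (f (a n)) \<le> L * (\<Prod>k\<in>F. pseudohyperbolic (a k) (a n))"
      using n by (intro Blaschke_divide_prod f) (auto simp: a f(3) subset_iff intro: inj_on_subset[OF inj])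
    then have "1 / L \<le> (\<Prod>k\<in>F. pseudohyperbolic (a k) (a n))"
      using \<open>L > 0\<close> n f(3) by (simp add: divide_simps mult.commute)
    then show "min 1 (1 / L) \<le> (\<Prod>k\<in>F. pseudohyperbolic (a k) (a n))" by simp
  qed
qed

section \<open>Lower bounds for finite Blaschke products\<close>

text \<open>Without the denominator, disks are described by inequalities between functions
  continuous on the whole plane, so openness and closedness are immediate.\<close>

lemma pseudohyperbolic_less_iff:
  assumes "norm a < 1" "norm z \<le> 1"
  shows "pseudohyperbolic a z < r \<longleftrightarrow> norm (z - a) < r * norm (1 - cnj a * z)"
    and "r < pseudohyperbolic a z \<longleftrightarrow> r * norm (1 - cnj a * z) < norm (z - a)"
  using one_minus_cnj_mult_nonzero[OF assms]
  by (simp_all add: pseudohyperbolic_def norm_divide norm_minus_commute divide_simps)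

text \<open>On the circle, conjugation is inversion. Hence the pseudohyperbolic distance from a
  point of the disk to the circle is 1.\<close>

lemma norm_one_minus_cnj_mult_circle:
  assumes "norm z = 1"
  shows "norm (1 - cnj a * z) = norm (z - a)"
proof -
  have "z * cnj z = 1" using assms by (simp add: complex_norm_square[symmetric])
  then have "1 - cnj a * z = z * cnj (z - a)" by (simp add: algebra_simps)
  then show ?thesis using assms by (simp only: norm_mult complex_mod_cnj mult_1)
qed

text \<open>The Lipschitz estimate for \<open>Moebius_function 0 a\<close>, whose bound is 1. It
  stands in for the triangle inequality.\<close>

lemma pseudohyperbolic_quasi_triangle:
  assumes "norm a < 1" "norm b < 1" "norm z < 1"
  shows "\<bar>pseudohyperbolic a z - pseudohyperbolic a b\<bar> \<le> 2 * pseudohyperbolic b z"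
proof -
  have "norm (Moebius_function 0 a z - Moebius_function 0 a b) \<le> 2 * 1 * pseudohyperbolic b z"
    using Moebius_function_norm_lt_1 assms
    by (intro Schwarz_Pick_Lipschitz Moebius_function_holomorphic) (auto intro: less_imp_le)
  then show ?thesis
    using norm_triangle_ineq3[of "Moebius_function 0 a z" "Moebius_function 0 a b"]
    by (simp add: pseudohyperbolic_Moebius)
qed

text \<open>The product \<open>H\<close> without factor \<open>n\<close> has modulus at least
  \<open>d\<close> at \<open>a n\<close> and varies by at most 2 * d/4, so it stays above d/2 on the
  circle; the remaining factor equals d/4 there.\<close>

lemma finite_Blaschke_lower_bound_circle:
  fixes a :: "'i \<Rightarrow> complex"
  assumes "finite F" and a: "\<And>k. k \<in> F \<Longrightarrow> norm (a k) < 1" and n: "n \<in> F"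
    and d: "d \<le> (\<Prod>k\<in>F - {n}. pseudohyperbolic (a k) (a n))"
    and z: "norm z < 1" "pseudohyperbolic (a n) z = d / 4"
  shows "d\<^sup>2 / 8 \<le> (\<Prod>k\<in>F. pseudohyperbolic (a k) z)"
proof -
  define H where "H = (\<lambda>z. \<Prod>k\<in>F - {n}. Moebius_function 0 (a k) z)"
  have norm_H: "norm (H z) = (\<Prod>k\<in>F - {n}. pseudohyperbolic (a k) z)" for z
    by (simp add: H_def prod_norm pseudohyperbolic_Moebius)
  have "norm (H z - H (a n)) \<le> 2 * 1 * pseudohyperbolic (a n) z"
  proof (rule Schwarz_Pick_Lipschitz)
    show "H holomorphic_on ball 0 1"
      unfolding H_def using a by (intro holomorphic_on_prod Moebius_function_holomorphic) auto
    show "norm (H z) \<le> 1" if "norm z < 1" for z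
      unfolding norm_H pseudohyperbolic_Moebius using Moebius_function_norm_lt_1[OF a that]
      by (intro prod_le_1) (auto intro: less_imp_le)
  qed (use a n z in auto)
  then have "norm (H z) \<ge> d / 2"
    using d norm_triangle_ineq3[of "H z" "H (a n)"] z by (simp add: norm_H)
  moreover have "d \<ge> 0" using z by (auto simp: pseudohyperbolic_def dest: sym[of _ "d/4"])
  ultimately have "d / 4 * (d / 2) \<le> d / 4 * norm (H z)" by (intro mult_left_mono) auto
  also have "\<dots> = (\<Prod>k\<in>F. pseudohyperbolic (a k) z)"
    using \<open>finite F\<close> n z by (simp add: norm_H prod.remove)
  finally show ?thesis by (simp add: power2_eq_square)
qed

text \<open>
  The reciprocal of the product is holomorphic off the pseudohyperbolic disks, so the maximum
  principle propagates the bound on their boundaries.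
\<close>

lemma finite_Blaschke_lower_bound:
  fixes a :: "'i \<Rightarrow> complex"
  assumes "finite F" and a: "\<And>k. k \<in> F \<Longrightarrow> norm (a k) < 1"
    and d: "0 < d" "d \<le> 1"
      "\<And>n. n \<in> F \<Longrightarrow> d \<le> (\<Prod>k\<in>F - {n}. pseudohyperbolic (a k) (a n))"
    and z: "norm z < 1" "\<And>k. k \<in> F \<Longrightarrow> d / 4 \<le> pseudohyperbolic (a k) z"
  shows "d\<^sup>2 / 8 \<le> (\<Prod>k\<in>F. pseudohyperbolic (a k) z)"
proof -
  define P where "P = (\<lambda>z. \<Prod>k\<in>F. Moebius_function 0 (a k) z)"
  \<comment> \<open>\<open>S\<close> is the part of the disk outside all closed small disks.
    \<open>T\<close> is a closed set containing \<open>S\<close>; its points outside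
    \<open>S\<close> lie on the unit circle or on the boundary of a small disk.\<close>
  define S where "S = ball 0 1 \<inter> (\<Inter>k\<in>F. {z. d / 4 * norm (1 - cnj (a k) * z) < norm (z - a k)})"
  define T where "T = cball 0 1 \<inter> (\<Inter>k\<in>F. {z. d / 4 * norm (1 - cnj (a k) * z) \<le> norm (z - a k)})"
  have norm_P: "norm (P z) = (\<Prod>k\<in>F. pseudohyperbolic (a k) z)" for z
    by (simp add: P_def prod_norm pseudohyperbolic_Moebius)
  have "open S"
    unfolding S_def
    by (intro open_Int open_INT open_ball \<open>finite F\<close> ballI open_Collect_less continuous_intros)
  have "closed T"
    unfolding T_def by (intro closed_Int closed_INT closed_cball ballI closed_Collect_le continuous_intros)
  moreover have "S \<subseteq> T" unfolding S_def T_def by (auto intro: less_imp_le)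
  ultimately have closure: "closure S \<subseteq> T" by (rule closure_minimal[rotated])
  have in_S: "w \<in> S \<longleftrightarrow> norm w < 1 \<and> (\<forall>k\<in>F. d / 4 < pseudohyperbolic (a k) w)" for w

    using pseudohyperbolic_less_iff(2)[OF a, of _ w "d / 4"] by (simp add: S_def) (meson less_imp_le)
  \<comment> \<open>The zeros \<open>a k\<close> violate the inequality defining \<open>T\<close> as
    \<open>d > 0\<close>, and the poles lie outside the closed unit disk.\<close>
  have T_nz: "w \<noteq> a k" "1 - cnj (a k) * w \<noteq> 0" if "w \<in> T" "k \<in> F" for w k
    using one_minus_cnj_mult_nonzero[OF a[OF \<open>k \<in> F\<close>], of w] that \<open>d > 0\<close>
    by (auto simp: T_def mult_le_0_iff)
  have P_nz: "P w \<noteq> 0" if "w \<in> T" for w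
    unfolding P_def using T_nz[OF that] \<open>finite F\<close> by (simp add: Moebius_function_simple)
  have frontier: "d\<^sup>2 / 8 \<le> norm (P w)" if "w \<in> T" "w \<notin> S" for w
  proof (cases "norm w = 1")
    case True
    then have "pseudohyperbolic (a k) w = 1" if "k \<in> F" for k
      using T_nz(1)[OF \<open>w \<in> T\<close> that] norm_one_minus_cnj_mult_circle[OF True, of "a k"]
      by (simp add: pseudohyperbolic_def norm_divide norm_minus_commute)
    moreover have "d\<^sup>2 \<le> 1" using d by (simp add: power_le_one)
    ultimately show ?thesis by (simp add: norm_P)
  next
    case False
    then have w: "norm w < 1" using that by (auto simp: T_def)
    then obtain k where k: "k \<in> F" "pseudohyperbolic (a k) w \<le> d / 4"
      using \<open>w \<notin> S\<close> in_S[of w] by (auto simp: not_less)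
    moreover have "\<not> pseudohyperbolic (a k) w < d / 4"
      using pseudohyperbolic_less_iff(1)[OF a[OF k(1)], of w "d / 4"] that w k by (auto simp: T_def)
    ultimately have "pseudohyperbolic (a k) w = d / 4" by simp
    then show ?thesis
      unfolding norm_P
      by (intro finite_Blaschke_lower_bound_circle[OF \<open>finite F\<close> a \<open>k \<in> F\<close> d(3)[OF \<open>k \<in> F\<close>] w])
  qed
  have "d\<^sup>2 / 8 \<le> norm (P z)"
  proof (cases "z \<in> S")
    case True
    have "norm (1 / P z) \<le> 8 / d\<^sup>2"
    proof (rule maximum_modulus_frontier[where f = "\<lambda>z. 1 / P z" and S = S, OF _ _ _ _ True])
      have "P holomorphic_on S"
        unfolding P_def using a
        by (intro holomorphic_on_prod holomorphic_on_subset[OF Moebius_function_holomorphic])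
          (auto simp: S_def)
      then show "(\<lambda>z. 1 / P z) holomorphic_on interior S"
        using P_nz \<open>S \<subseteq> T\<close> by (simp add: interior_open[OF \<open>open S\<close>]) (intro holomorphic_intros, auto)
      have "continuous_on T (\<lambda>z. 1 / P z)"
        using P_nz T_nz unfolding P_def Moebius_function_simple
        by (intro continuous_intros) (simp_all add: P_def Moebius_function_simple)
      then show "continuous_on (closure S) (\<lambda>z. 1 / P z)"
        using closure by (rule continuous_on_subset)
      show "bounded S" unfolding S_def by (intro bounded_Int disjI1 bounded_ball)
      show "norm (1 / P w) \<le> 8 / d\<^sup>2" if "w \<in> frontier S" for w
      proof -
        have "w \<in> T" "w \<notin> S"
          using that closure \<open>open S\<close> by (auto simp: frontier_def interior_open)
        then show ?thesis
          using frontier[of w] P_nz[of w] \<open>d > 0\<close> by (simp add: norm_divide divide_simps mult.commute)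
      qed
    qed
    then show ?thesis
      using P_nz[of z] True \<open>S \<subseteq> T\<close> \<open>d > 0\<close> by (auto simp: norm_divide divide_simps mult.commute)
  next
    case False
    moreover have "z \<in> T"
      using z pseudohyperbolic_less_iff(1)[OF a, of _ z "d / 4"] by (auto simp: T_def not_less[symmetric])
    ultimately show ?thesis using frontier by blast
  qed
  then show ?thesis by (simp add: norm_P)
qed

section \<open>Convergence of the Blaschke product\<close>

lemma norm_blaschke_factor:
  assumes "a \<noteq> 0"
  shows "norm (blaschke_factor a z) = pseudohyperbolic a z"
  using assms by (simp add: blaschke_factor_def pseudohyperbolic_def norm_mult norm_divide)

text \<open>After clearing denominators, the difference from 1 has the factor 1 - |a|, so the
  Blaschke condition yields absolute convergence of the product.\<close>

lemma norm_blaschke_factor_minus_1: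
  assumes "a \<noteq> 0" "norm a < 1" "norm z < 1"
  shows "norm (blaschke_factor a z - 1) \<le> 2 / (1 - norm z) * (1 - norm a)"
proof -
  have nz: "1 - cnj a * z \<noteq> 0" using assms by (intro one_minus_cnj_mult_nonzero) auto
  have aa: "a * cnj a = of_real (norm a) * of_real (norm a)"
    by (simp add: complex_norm_square[symmetric] power2_eq_square flip: of_real_mult)
  have "(blaschke_factor a z - 1) * (a * (1 - cnj a * z))
      = of_real (norm a) * (a - z) - (a - (a * cnj a) * z)"
    using nz \<open>a \<noteq> 0\<close> by (simp add: blaschke_factor_def field_simps)
  also have "\<dots> = - (1 - of_real (norm a)) * (a + of_real (norm a) * z)"
    unfolding aa by (simp add: algebra_simps)
  finally have "norm (blaschke_factor a z - 1) * (norm a * norm (1 - cnj a * z))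
      = norm (- (1 - complex_of_real (norm a)) * (a + of_real (norm a) * z))"
    by (metis norm_mult)
  also have "\<dots> = (1 - norm a) * norm (a + of_real (norm a) * z)"
  proof -
    have "norm (- (1 - complex_of_real (norm a))) = norm (complex_of_real (1 - norm a))"
      by (simp add: norm_minus_commute)
    also have "\<dots> = 1 - norm a" unfolding norm_of_real using assms by simp
    finally show ?thesis by (simp only: norm_mult)
  qed
  also have "\<dots> \<le> (1 - norm a) * (2 * norm a)"
  proof (rule mult_left_mono)
    have "norm (a + of_real (norm a) * z) \<le> norm a + norm a * norm z"
      using norm_triangle_ineq[of a "of_real (norm a) * z"] by (simp add: norm_mult)
    also have "\<dots> \<le> norm a + norm a * 1" using assms by (intro add_left_mono mult_left_mono) auto
    finally show "norm (a + of_real (norm a) * z) \<le> 2 * norm a" by simp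
  qed (use assms in simp)
  finally have "norm (blaschke_factor a z - 1) * norm (1 - cnj a * z) \<le> (1 - norm a) * 2"
    using \<open>a \<noteq> 0\<close> by (simp add: mult.left_commute[of _ "norm a"] mult.assoc)
  moreover have "norm (blaschke_factor a z - 1) * (1 - norm z)
      \<le> norm (blaschke_factor a z - 1) * norm (1 - cnj a * z)"
  proof (rule mult_left_mono)
    have "norm (cnj a * z) \<le> 1 * norm z"
      unfolding norm_mult complex_mod_cnj using assms by (intro mult_right_mono) auto
    then show "1 - norm z \<le> norm (1 - cnj a * z)"
      using norm_triangle_ineq2[of 1 "cnj a * z"] by simp
  qed simp
  ultimately show ?thesis using assms by (simp add: field_simps)
qed

text \<open>Writes |B| as a limit of finite products over the full zero sequence, the form to which
  the finite bound applies.\<close>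

lemma blaschke_form_limit:
  assumes B: "blaschke_form c m N \<alpha> B" and z: "norm z < 1"
  shows "(\<lambda>K. \<Prod>k | k < m + Suc K \<and> enat k < enat m + N. pseudohyperbolic (zero_sequence m \<alpha> k) z)
    \<longlonglongrightarrow> norm (B z)"
proof -
  define f where "f = (\<lambda>n. if enat n < N then blaschke_factor (\<alpha> n) z else 1)"
  have \<alpha>: "norm (\<alpha> n) < 1" "\<alpha> n \<noteq> 0" if "enat n < N" for n
    using B that by (auto simp: blaschke_form_def blaschke_sequence_def)
  have "summable (\<lambda>n. norm (f n - 1))"
  proof (rule summable_comparison_test')
    show "summable (\<lambda>n. 2 / (1 - norm z) * (if enat n < N then 1 - norm (\<alpha> n) else 0))"
      using B by (intro summable_mult) (simp add: blaschke_form_def blaschke_sequence_def)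
    show "norm (norm (f n - 1)) \<le> 2 / (1 - norm z) * (if enat n < N then 1 - norm (\<alpha> n) else 0)" for n
      using norm_blaschke_factor_minus_1[OF \<alpha>(2,1) z] by (simp add: f_def)
  qed
  then have "(\<lambda>K. \<Prod>i\<le>K. f i) \<longlonglongrightarrow> prodinf f"
    by (intro convergent_prod_LIMSEQ abs_convergent_prod_imp_convergent_prod
        summable_imp_abs_convergent_prod)
  then have "(\<lambda>K. norm (c * z ^ m * (\<Prod>i\<le>K. f i))) \<longlonglongrightarrow> norm (c * z ^ m * prodinf f)"
    by (intro tendsto_intros)
  also have "c * z ^ m * prodinf f = B z"
    using B z by (simp add: blaschke_form_def f_def)
  also have "(\<lambda>K. norm (c * z ^ m * (\<Prod>i\<le>K. f i))) =
    (\<lambda>K. \<Prod>k | k < m + Suc K \<and> enat k < enat m + N. pseudohyperbolic (zero_sequence m \<alpha> k) z)"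
  proof
    fix K
    \<comment> \<open>The first \<open>m\<close> indices give |z|^m. The others are shifted by
      \<open>m\<close>, and the cutoff \<open>m + Suc K\<close> matches the range
      \<open>i \<le> K\<close>; missing indices contribute the default factor 1.\<close>
    have split: "{k. k < m + Suc K \<and> enat k < enat m + N} =
        {..<m} \<union> (+) m ` {i \<in> {..K}. enat i < N}" (is "_ = _ \<union> ?J")
    proof (rule set_eqI)
      fix k
      show "k \<in> {k. k < m + Suc K \<and> enat k < enat m + N} \<longleftrightarrow> k \<in> {..<m} \<union> ?J"
      proof (cases "k < m")
        case True
        then show ?thesis by (cases N) auto
      next
        case False
        then obtain i where "k = m + i" by (metis le_add_diff_inverse not_less)
        then show ?thesis by (cases N) auto
      qed
    qed
    have "(\<Prod>k\<in>{..<m} \<union> ?J. pseudohyperbolic (zero_sequence m \<alpha> k) z) =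
      (\<Prod>k<m. pseudohyperbolic (zero_sequence m \<alpha> k) z) *
      (\<Prod>k\<in>?J. pseudohyperbolic (zero_sequence m \<alpha> k) z)"
      by (rule prod.union_disjoint) auto
    also have "(\<Prod>k<m. pseudohyperbolic (zero_sequence m \<alpha> k) z) = norm z ^ m"
      by (simp add: zero_sequence_def pseudohyperbolic_def)
    also have "(\<Prod>k\<in>?J. pseudohyperbolic (zero_sequence m \<alpha> k) z) =
      (\<Prod>i | i \<in> {..K} \<and> enat i < N. norm (f i))"
      by (subst prod.reindex)
        (auto simp: zero_sequence_def f_def norm_blaschke_factor \<alpha> intro!: prod.cong)
    also have "\<dots> = (\<Prod>i\<le>K. norm (f i))"
      by (rule prod.mono_neutral_left) (auto simp: f_def)
    finally show "norm (c * z ^ m * (\<Prod>i\<le>K. f i)) =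
      (\<Prod>k | k < m + Suc K \<and> enat k < enat m + N. pseudohyperbolic (zero_sequence m \<alpha> k) z)"
      unfolding split using B by (simp add: norm_mult norm_power prod_norm blaschke_form_def)
  qed
  finally show ?thesis .
qed

section \<open>Components of the sublevel set\<close>

text \<open>The single level \<open>\<epsilon>\<close> witnesses both requirements: each component
  is trapped in one disk of radius d/4, which stays away from the circle and has small
  diameter.\<close>

lemma weak_property_H_if_small_near_separated:
  fixes a :: "'i \<Rightarrow> complex"
  assumes a: "\<And>n. n \<in> A \<Longrightarrow> norm (a n) < 1"
    and d: "0 < d" "d \<le> 1"
      "\<And>n k. n \<in> A \<Longrightarrow> k \<in> A \<Longrightarrow> n \<noteq> k \<Longrightarrow> d \<le> pseudohyperbolic (a k) (a n)"
    and \<epsilon>: "0 < \<epsilon>" "\<epsilon> < 1"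
    and large: "\<And>z. norm z < 1 \<Longrightarrow> (\<And>n. n \<in> A \<Longrightarrow> d / 4 \<le> pseudohyperbolic (a n) z) \<Longrightarrow>
      \<epsilon> \<le> norm (u z)"
  shows "weak_property_H u"
proof -
  define D where "D n = ball 0 1 \<inter> {z. norm (z - a n) < d / 4 * norm (1 - cnj (a n) * z)}" for n
  have D_iff: "z \<in> D n \<longleftrightarrow> norm z < 1 \<and> pseudohyperbolic (a n) z < d / 4" if "n \<in> A" for n z
    using pseudohyperbolic_less_iff(1)[OF a[OF that], of z "d / 4"] by (auto simp: D_def)
  have open_D: "open (D n)" for n
    unfolding D_def by (intro open_Int open_ball open_Collect_less continuous_intros)
  \<comment> \<open>A common point would give rho(a k, a n) < d/4 + 2 * d/4 < d.\<close>
  have disjoint: "D n \<inter> D k = {}" if "n \<in> A" "k \<in> A" "n \<noteq> k" for n k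
  proof (rule equals0I)
    fix z assume "z \<in> D n \<inter> D k"
    then show False
      using d(1) d(3)[OF that] pseudohyperbolic_quasi_triangle[of "a k" "a n" z] a that
      by (auto simp: D_iff)
  qed
  have Omega: "Omega u \<epsilon> \<subseteq> (\<Union>n\<in>A. D n)"
  proof
    fix z assume "z \<in> Omega u \<epsilon>"
    then have z: "norm z < 1" "norm (u z) < \<epsilon>" by (auto simp: Omega_def)
    then obtain n where "n \<in> A" "pseudohyperbolic (a n) z < d / 4"
      using large[OF z(1)] by force
    then show "z \<in> (\<Union>n\<in>A. D n)" using z D_iff by blast
  qed
  have component: "\<exists>n\<in>A. C \<subseteq> D n" if C: "C \<in> components (Omega u \<epsilon>)" for C
  proof -
    have sub: "C \<subseteq> (\<Union>n\<in>A. D n)" using in_components_subset[OF C] Omega by blast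
    obtain z where "z \<in> C" using in_components_nonempty[OF C] by blast
    then obtain n where n: "n \<in> A" "z \<in> D n" using sub by blast
    \<comment> \<open>\<open>D n\<close> and the union of the other disks are open, disjoint and
      cover the connected set \<open>C\<close>, so \<open>C\<close> meets only one of them.\<close>
    have "D n \<inter> C = {} \<or> (\<Union>k\<in>A - {n}. D k) \<inter> C = {}"
    proof (rule connectedD[OF in_components_connected[OF C] open_D])
      show "D n \<inter> (\<Union>k\<in>A - {n}. D k) \<inter> C = {}" using disjoint n by blast
    qed (use sub open_D in auto)
    then have "(\<Union>k\<in>A - {n}. D k) \<inter> C = {}" using \<open>z \<in> C\<close> n by blast
    then show ?thesis using sub n by blast
  qed
  have "closure C \<subseteq> ball 0 1" if C: "C \<in> components (Omega u \<epsilon>)" for C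
  proof -
    obtain n where n: "n \<in> A" "C \<subseteq> D n" using component[OF C] by blast
    define T where "T = cball 0 1 \<inter> {z. norm (z - a n) \<le> d / 4 * norm (1 - cnj (a n) * z)}"
    have "closed T"
      unfolding T_def by (intro closed_Int closed_cball closed_Collect_le continuous_intros)
    moreover have "C \<subseteq> T" using n(2) unfolding D_def T_def by (auto intro: less_imp_le)
    ultimately have "closure C \<subseteq> T" by (rule closure_minimal[rotated])
    \<comment> \<open>On the circle the two norms defining \<open>T\<close> coincide and are
      positive, which is incompatible with d/4 < 1.\<close>
    moreover have "norm z \<noteq> 1" if "z \<in> T" for z
    proof
      assume "norm z = 1"
      then have "norm (z - a n) \<le> d / 4 * norm (z - a n)"
        using that norm_one_minus_cnj_mult_circle[of z "a n"] by (simp add: T_def)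
      moreover have "norm (z - a n) > 0" using \<open>norm z = 1\<close> a[OF n(1)] by auto
      ultimately show False using d by simp
    qed
    ultimately show ?thesis by (force simp: T_def)
  qed
  then have "weak_property_B u"
    unfolding weak_property_B_def using \<epsilon> by (intro bexI[of _ \<epsilon>]) auto
  \<comment> \<open>Passing through the centre gives rho(z, w) \<le> rho(z, a n) + 2 * rho(a n, w) <
    3d/4.\<close>
  moreover have "delta u \<epsilon> \<le> 3 / 4 * d"
    unfolding delta_def
  proof (rule cSup_least)
    fix x assume "x \<in> insert 0
      {pseudohyperbolic z w | z w C. C \<in> components (Omega u \<epsilon>) \<and> z \<in> C \<and> w \<in> C}"
    then consider "x = 0" | z w C where "x = pseudohyperbolic z w"
      "C \<in> components (Omega u \<epsilon>)" "z \<in> C" "w \<in> C" by blast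
    then show "x \<le> 3 / 4 * d"
    proof cases
      case 2
      then obtain n where n: "n \<in> A" "z \<in> D n" "w \<in> D n" using component by blast
      then show ?thesis
        using pseudohyperbolic_quasi_triangle[of z "a n" w] a[OF n(1)] 2(1)
          pseudohyperbolic_commute[of "a n" z] by (auto simp: D_iff)
    qed (use d in auto)
  qed auto
  ultimately show ?thesis
    unfolding weak_property_H_def using \<epsilon> d by (auto intro!: bexI[of _ \<epsilon>])
qed

theorem proposition4p13:
  fixes B :: "complex \<Rightarrow> complex"
  assumes "interpolating_blaschke_product B"
  shows "weak_property_H B"
proof -
  obtain c m N \<alpha> where B: "blaschke_form c m N \<alpha> B"
    and interp: "interpolating_sequence (enat m + N) (zero_sequence m \<alpha>)"
    using assms by (auto simp: interpolating_blaschke_product_def)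
  define a where "a = zero_sequence m \<alpha>"
  define A where "A = {k. enat k < enat m + N}"
  have a: "norm (a k) < 1" if "k \<in> A" for k
  proof (cases "k < m")
    case False
    then obtain i where "k = m + i" by (metis le_add_diff_inverse not_less)
    moreover from this have "enat i < N" using that by (cases N) (auto simp: A_def)
    ultimately show ?thesis
      using B by (auto simp: a_def zero_sequence_def blaschke_form_def blaschke_sequence_def)
  qed (simp add: a_def zero_sequence_def)
  obtain d where d: "0 < d" "d \<le> 1"
    "\<And>n F. n \<in> A \<Longrightarrow> finite F \<Longrightarrow> F \<subseteq> A - {n} \<Longrightarrow>
      d \<le> (\<Prod>k\<in>F. pseudohyperbolic (a k) (a n))"
    using interpolating_imp_uniformly_separated[of A a] a interp
    by (auto simp: interpolating_sequence_def a_def A_def)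
  have "d\<^sup>2 \<le> 1" using d by (simp add: power_le_one)
  show ?thesis
  proof (rule weak_property_H_if_small_near_separated[OF a d(1,2), where A = A and \<epsilon> = "d\<^sup>2 / 8"])
    show "d \<le> pseudohyperbolic (a k) (a n)" if "n \<in> A" "k \<in> A" "n \<noteq> k" for n k
      using d(3)[of n "{k}"] that by simp
    fix z assume z: "norm z < 1" "\<And>n. n \<in> A \<Longrightarrow> d / 4 \<le> pseudohyperbolic (a n) z"
    \<comment> \<open>All truncations share the same \<open>d\<close>, since the separation holds
      for every finite set of indices; the bound is uniform in \<open>K\<close> and passes to the
      limit.\<close>
    have "d\<^sup>2 / 8 \<le> (\<Prod>k | k < m + Suc K \<and> k \<in> A. pseudohyperbolic (a k) z)" for K
      by (rule finite_Blaschke_lower_bound[OF _ a d(1,2) d(3) z(1) z(2)]) auto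
    then show "d\<^sup>2 / 8 \<le> norm (B z)"
      using blaschke_form_limit[OF B z(1)] unfolding a_def A_def
      by (intro Lim_bounded2) auto
  qed (use d \<open>d\<^sup>2 \<le> 1\<close> in auto)
qed

end
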